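(* Let $V\neq\emptyset$ be a finite set and let $(\Delta,\sigma)$ be a subdivision of the simplex $2^V$. Then $$\ell_V(\Delta,x)=\sum_{F\subseteq V}\big[h(\Delta_F,x)-h(\partial(\Delta_F),x)\big]\cdot\mathfrak{d}_{|V\setminus F|}(x).$$
   Context: For a simplicial complex $K$ of dimension $e-1$ with $f_{i-1}(K)$ faces of cardinality $i$, $h(K,x)=\sum_{i=0}^{e} f_{i-1}(K)x^i(1-x)^{e-i}$. A subdivision of $2^V$ is a pair $(\Delta,\sigma)$, $\Delta$ a finite simplicial complex, $\sigma:\Delta\to 2^V$ a map such that for each $F\subseteq V$, $\Delta_F:=\sigma^{-1}(2^F)$ is a subcomplex homeomorphic to a ball of dimension $|F|-1$ and $\sigma^{-1}(F)$ is the set of interior faces of $\Delta_F$. The local $h$-polynomial is $\ell_V(\Delta,x)=\sum_{F\subseteq V}(-1)^{|V|-|F|}h(\Delta_F,x)$. For $F\neq\emptyset$, $\partial(\Delta_F)=\bigcup_{G\subsetneq F}\Delta_G$ is the boundary of the ball $\Delta_F$, a complex of dimension $|F|-2$ whose $h$-polynomial is computed with $e=|F|-1$; for $F=\emptyset$ the convention is $h(\Delta_\emptyset,x)-h(\partial(\Delta_\emptyset),x)=1$ (i.e., $h(\Delta_\emptyset,x)=1$ and $h(\partial(\Delta_\emptyset),x)=0$). For $\pi\in S_n$, $\mathrm{exc}(\pi)=|\{i:\pi(i)>i\}|$; $\mathfrak{d}_n(x)=\sum_{\pi}x^{\mathrm{exc}(\pi)}$, the sum over fixed-point-free $\pi\in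 S_n$, for $n\geq1$, and $\mathfrak{d}_0(x)=1$. *)

theory Defs
  imports
    "HOL-Analysis.Analysis"
    "HOL-Computational_Algebra.Polynomial"
    "HOL-Combinatorics.Permutations"
begin

definition fin_simplicial_complex :: "'a set set \<Rightarrow> bool" where
  "fin_simplicial_complex K \<longleftrightarrow>
     finite K \<and> (\<forall>E\<in>K. finite E) \<and> (\<forall>E\<in>K. \<forall>D. D \<subseteq> E \<longrightarrow> D \<in> K)"

text \<open>Barycentric coordinates; the subspace topology of the product topology is the usual
  topology because only finite complexes are considered.\<close>

definition realization_points :: "'a set set \<Rightarrow> ('a \<Rightarrow> real) set" where
  "realization_points K =
     {p. (\<forall>v. 0 \<le> p v) \<and> {v. p v \<noteq> 0} \<in> K \<and> (\<Sum>v\<in>{v. p v \<noteq> 0}. p v) = 1}"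

definition realization :: "'a set set \<Rightarrow> ('a \<Rightarrow> real) topology" where
  "realization K = subtopology (powertop_real UNIV) (realization_points K)"

definition closed_ball_top :: "nat \<Rightarrow> (nat \<Rightarrow> real) topology" where
  "closed_ball_top n = subtopology (Euclidean_space n) {x. (\<Sum>i<n. (x i)\<^sup>2) \<le> 1}"

text \<open>The only ball of dimension \<open>-1\<close> is the complex whose single face is the empty set.\<close>

definition is_ball_of_dim :: "'a set set \<Rightarrow> int \<Rightarrow> bool" where
  "is_ball_of_dim K d \<longleftrightarrow>
     (d = -1 \<and> K = {{}}) \<or>
     (d \<ge> 0 \<and> realization K homeomorphic_space closed_ball_top (nat d))"

text \<open>Points corresponding to the bounding sphere of a topological ball. By invariance of domain
  the choice of the homeomorphism is irrelevant.\<close>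

definition ball_boundary_points :: "'b topology \<Rightarrow> 'b set" where
  "ball_boundary_points X =
     {p \<in> topspace X. \<exists>n f. homeomorphic_map X (closed_ball_top n) f \<and> (\<Sum>i<n. (f p i)\<^sup>2) = 1}"

text \<open>A face of a ball is interior if it is not contained in the boundary of the ball. The empty
  face lies in the boundary of every ball of dimension at least \<open>0\<close>, but the boundary of the
  \<open>-1\<close>-dimensional ball has no faces at all.\<close>

definition interior_faces :: "'a set set \<Rightarrow> 'a set set" where
  "interior_faces K =
     (if K = {{}} then {{}}
      else {E \<in> K. \<not> realization_points (Pow E) \<subseteq> ball_boundary_points (realization K)})"

definition restr :: "'a set set \<Rightarrow> ('a set \<Rightarrow> 'v set) \<Rightarrow> 'v set \<Rightarrow> 'a set set" where
  "restr \<Delta> \<sigma> F = {E \<in> \<Delta>. \<sigma> E \<subseteq> F}"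

definition restr_boundary :: "'a set set \<Rightarrow> ('a set \<Rightarrow> 'v set) \<Rightarrow> 'v set \<Rightarrow> 'a set set" where
  "restr_boundary \<Delta> \<sigma> F = (\<Union>G\<in>{G. G \<subset> F}. restr \<Delta> \<sigma> G)"

definition is_subdivision :: "'v set \<Rightarrow> 'a set set \<Rightarrow> ('a set \<Rightarrow> 'v set) \<Rightarrow> bool" where
  "is_subdivision V \<Delta> \<sigma> \<longleftrightarrow>
     fin_simplicial_complex \<Delta> \<and>
     (\<forall>E\<in>\<Delta>. \<sigma> E \<subseteq> V) \<and>
     (\<forall>F. F \<subseteq> V \<longrightarrow>
        fin_simplicial_complex (restr \<Delta> \<sigma> F) \<and>
        is_ball_of_dim (restr \<Delta> \<sigma> F) (int (card F) - 1) \<and>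
        {E \<in> \<Delta>. \<sigma> E = F} = interior_faces (restr \<Delta> \<sigma> F))"

definition num_faces :: "'a set set \<Rightarrow> nat \<Rightarrow> nat" where
  "num_faces K i = card {E \<in> K. card E = i}"

text \<open>Here \<open>e - 1\<close> is the dimension of \<open>K\<close>. For the void complex \<open>{}\<close> all face numbers vanish,
  so the value is \<open>0\<close> whatever \<open>e\<close> is.\<close>

definition h_poly :: "'a set set \<Rightarrow> int poly" where
  "h_poly K = (let e = Max (card ` K) in
     \<Sum>i=0..e. of_nat (num_faces K i) * [:0, 1:] ^ i * [:1, -1:] ^ (e - i))"

definition local_h_poly :: "'v set \<Rightarrow> 'a set set \<Rightarrow> ('a set \<Rightarrow> 'v set) \<Rightarrow> int poly" where
  "local_h_poly V \<Delta> \<sigma> =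
     (\<Sum>F\<in>Pow V. (-1) ^ (card V - card F) * h_poly (restr \<Delta> \<sigma> F))"

definition exc :: "nat \<Rightarrow> (nat \<Rightarrow> nat) \<Rightarrow> nat" where
  "exc n \<pi> = card {i \<in> {1..n}. \<pi> i > i}"

definition derangement_poly :: "nat \<Rightarrow> int poly" where
  "derangement_poly n =
     (\<Sum>\<pi> | \<pi> permutes {1..n} \<and> (\<forall>i\<in>{1..n}. \<pi> i \<noteq> i). [:0, 1:] ^ exc n \<pi>)"

lemma derangement_poly_0: "derangement_poly 0 = 1"
  by (simp add: derangement_poly_def exc_def)

lemma h_poly_void: "h_poly {} = 0"
  by (simp add: h_poly_def num_faces_def)

lemma h_poly_empty_face: "h_poly {{}} = 1"
proof -
  have "{E. E = {} \<and> card E = 0} = {{} :: 'a set}"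
    by auto
  then show ?thesis
    by (simp add: h_poly_def num_faces_def)
qed

lemma restr_boundary_empty: "restr_boundary \<Delta> \<sigma> {} = {}"
  by (simp add: restr_boundary_def)

end

theory Submission
  imports Defs "HOL-Homology.Invariance_of_Domain"
begin

text \<open>Invariance of domain shows that \<open>\<Delta>\<^sub>F\<close> has dimension exactly \<open>|F| - 1\<close>, so every face \<open>E\<close> satisfies
  \<open>|E| \<le> |\<sigma>(E)|\<close> and the exponents in all the \<open>h\<close>-polynomials are known. Put
  \<open>g(G) = \<Sum> x\<^bsup>|E|\<^esup> (1-x)\<^bsup>|G|-|E|\<^esup>\<close>, summed over the faces \<open>E\<close> with carrier \<open>\<sigma>(E) = G\<close>. Then \<open>h(\<Delta>\<^sub>F)\<close> is the sum
  of \<open>g(G) (1-x)\<^bsup>|F|-|G|\<^esup>\<close> over \<open>G \<subseteq> F\<close>, and \<open>h(\<partial>\<Delta>\<^sub>F)\<close> the sum of \<open>g(G) (1-x)\<^bsup>|F|-|G|-1\<^esup>\<close> over \<open>G \<subset> F\<close>.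
  Comparing the coefficients of \<open>g(G)\<close>, with \<open>n = |V| - |G|\<close>, reduces the theorem to
  \<open>d\<^sub>n - x \<Sum>\<^bsub>k\<ge>1\<^esub> (n choose k) (1-x)\<^bsup>k-1\<^esup> d\<^bsub>n-k\<^esub> = (-x)\<^bsup>n\<^esup>\<close>, which follows from the recurrence
  \<open>d\<^bsub>n+1\<^esub> = n x d\<^sub>n + x (1-x) d\<^sub>n' + n x d\<^bsub>n-1\<^esub>\<close>.\<close>

section \<open>Dimension of triangulated balls\<close>

lemma continuous_map_Euclidean_space_coordinate:
  "continuous_map (Euclidean_space n) euclideanreal (\<lambda>x. x i)"
  unfolding Euclidean_space_def
  by (intro continuous_map_from_subtopology continuous_map_product_projection) auto

text \<open>Invariance of dimension from invariance of domain: if n < m, the image of U would be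
  open in m-space while lying in the hyperplane where coordinate n vanishes.\<close>

lemma Euclidean_space_injective_imp_le:
  assumes U: "openin (Euclidean_space m) U" "U \<noteq> {}"
    and f: "continuous_map (subtopology (Euclidean_space m) U) (Euclidean_space n) f"
    and inj: "inj_on f U"
  shows "m \<le> n"
proof (rule ccontr)
  assume "\<not> m \<le> n"
  then have nm: "n < m" by simp
  have UE: "U \<subseteq> topspace (Euclidean_space m)"
    using U(1) by (rule openin_subset)
  have fU: "f x \<in> topspace (Euclidean_space n)" if "x \<in> U" for x
    using continuous_map_image_subset_topspace[OF f] that UE by auto
  have "continuous_map (subtopology (Euclidean_space m) U) (Euclidean_space m) f"
  proof -
    have "Euclidean_space n = subtopology (Euclidean_space m) (topspace (Euclidean_space n))"
      by (metis Euclidean_space_def inf.absorb_iff2 less_imp_le nm subset_Euclidean_space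
          subtopology_subtopology topspace_Euclidean_space)
    with f show ?thesis
      by (metis continuous_map_into_fulltopology)
  qed
  then have op: "openin (Euclidean_space m) (f ` U)"
    by (rule invariance_of_domain_Euclidean_space[OF U(1) _ inj])
  obtain q where q: "q \<in> f ` U" using U(2) by auto
  then have q0: "q i = 0" if "i \<ge> n" for i
    using fU that by (auto simp: topspace_Euclidean_space)
  \<comment> \<open>The line through q in direction n meets the image of U only at t = 0, but its
    preimage of an open set cannot be a single point.\<close>
  define c where "c = (\<lambda>t::real. q(n := t))"
  have "continuous_map euclideanreal euclideanreal (\<lambda>t. c t i)" for i
    by (cases "i = n") (simp_all add: c_def)
  moreover have "c t i = 0" if "i \<ge> m" for t i
    using that nm q0 by (simp add: c_def)
  ultimately have "continuous_map euclideanreal (Euclidean_space m) c"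
    by (auto simp: Euclidean_space_def continuous_map_in_subtopology continuous_map_componentwise_UNIV)
  then have "openin euclideanreal {t \<in> topspace euclideanreal. c t \<in> f ` U}"
    using op by (rule openin_continuous_map_preimage)
  moreover have "{t \<in> topspace euclideanreal. c t \<in> f ` U} = {0}"
  proof -
    have "t = 0" if "c t \<in> f ` U" for t
    proof -
      from that have "c t \<in> topspace (Euclidean_space n)" by (metis fU imageE)
      then have "c t n = 0" by (simp add: topspace_Euclidean_space)
      then show ?thesis by (simp add: c_def)
    qed
    moreover have "c 0 = q" using q0[of n] by (auto simp: c_def)
    ultimately show ?thesis using q by auto
  qed
  ultimately show False
    using not_open_singleton[of "0::real"] by simp
qed

lemma continuous_map_into_realization:
  "continuous_map X (realization K) f \<longleftrightarrow>
     (\<forall>v. continuous_map X euclideanreal (\<lambda>x. f x v)) \<and> f \<in> topspace X \<rightarrow> realization_points K"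
  by (simp add: realization_def continuous_map_in_subtopology continuous_map_componentwise_UNIV)

lemma topspace_realization [simp]: "topspace (realization K) = realization_points K"
  by (simp add: realization_def)

text \<open>Applied to the open unit ball, this bounds the dimension of a triangulated ball from
  below.\<close>

lemma support_face_of_open_embedding:
  assumes K: "fin_simplicial_complex K"
    and U: "openin (Euclidean_space n) U" "U \<noteq> {}"
    and f: "continuous_map (subtopology (Euclidean_space n) U) (realization K) f"
    and inj: "inj_on f U"
  obtains E where "E \<in> K" "n < card E"
proof -
  define s where "s = (\<lambda>x. {v. f x v \<noteq> 0})"
  have UE: "U \<subseteq> topspace (Euclidean_space n)"
    using U(1) by (rule openin_subset)
  have fv: "continuous_map (subtopology (Euclidean_space n) U) euclideanreal (\<lambda>x. f x v)" for v
    using f by (auto simp: continuous_map_into_realization)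
  have fU: "f x \<in> realization_points K" if "x \<in> U" for x
    using continuous_map_image_subset_topspace[OF f] that UE by auto
  then have sK: "s x \<in> K" and fsum: "sum (f x) (s x) = 1" if "x \<in> U" for x
    using that by (auto simp: s_def realization_points_def)
  have "finite (s ` U)"
    using K sK by (auto simp: fin_simplicial_complex_def intro: finite_subset[of _ K])
  moreover have "s ` U \<noteq> {}" using U(2) by simp
  \<comment> \<open>On the open set of points of \<open>U\<close> whose support contains a maximal support \<open>E\<close>, the support is
    exactly \<open>E\<close>, so all barycentric coordinates but one embed that set in a space of dimension
    \<open>card E - 1\<close>.\<close>
  ultimately obtain E where E: "E \<in> s ` U" and maxE: "\<And>D. D \<in> s ` U \<Longrightarrow> E \<subseteq> D \<Longrightarrow> D = E"
    using finite_has_maximal[of "s ` U"] by metis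
  from E obtain x0 where x0: "x0 \<in> U" "s x0 = E" by auto
  have EK: "E \<in> K" using E sK by auto
  have finE: "finite E" using EK K by (auto simp: fin_simplicial_complex_def)
  have neE: "E \<noteq> {}" using fsum[OF x0(1)] x0(2) by auto
  \<comment> \<open>The product is nonzero iff the support contains E, hence equals E by maximality.
    This exhibits W as the preimage of an open set.\<close>
  define W where "W = {x \<in> U. (\<Prod>v\<in>E. f x v) \<in> - {0}}"
  have Wiff: "x \<in> W \<longleftrightarrow> x \<in> U \<and> s x = E" for x
    using maxE[of "s x"] finE by (auto simp: W_def s_def)
  have "continuous_map (subtopology (Euclidean_space n) U) euclideanreal (\<lambda>x. \<Prod>v\<in>E. f x v)"
    by (intro continuous_map_prod finE fv)
  from openin_continuous_map_preimage[OF this, of "- {0}"]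
  have "openin (subtopology (Euclidean_space n) U) W"
    using UE by (simp add: W_def Int_absorb1 open_Compl)
  then have Wop: "openin (Euclidean_space n) W"
    using U(1) openin_trans_full by blast
  obtain m where m: "card E = Suc m"
    using finE neE by (metis card_eq_0_iff not0_implies_Suc)
  obtain b where b: "bij_betw b {..<Suc m} E"
    using ex_bij_betw_nat_finite[OF finE] m by (auto simp: atLeast0LessThan)
  define g where "g = (\<lambda>x i. if i < m then f x (b i) else 0)"
  have "continuous_map (subtopology (Euclidean_space n) W) euclideanreal (\<lambda>x. f x v)" for v
    by (rule continuous_map_from_subtopology_mono[OF fv]) (auto simp: W_def)
  then have gc: "continuous_map (subtopology (Euclidean_space n) W) (Euclidean_space m) g"
    unfolding g_def by (subst continuous_map_componentwise_Euclidean_space) auto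
  have "inj_on g W"
  proof (rule inj_onI)
    fix x y assume xy: "x \<in> W" "y \<in> W" "g x = g y"
    have eq: "f x (b i) = f y (b i)" if "i < m" for i
      using fun_cong[OF xy(3), of i] that by (simp add: g_def)
    \<comment> \<open>The coordinate at \<open>b m\<close>, which g omits, is recovered from the
      total 1.\<close>
    have tot: "(\<Sum>i<Suc m. f z (b i)) = 1" if "z \<in> W" for z
      using sum.reindex_bij_betw[OF b, of "f z"] fsum[of z] that by (auto simp: Wiff)
    have "f x (b m) = f y (b m)"
      using tot[OF xy(1)] tot[OF xy(2)] eq by simp
    then have "f x (b i) = f y (b i)" if "i < Suc m" for i
      using eq that less_Suc_eq by auto
    then have "f x v = f y v" if "v \<in> E" for v
      using b that by (auto simp: bij_betw_def)
    moreover have "f z v = 0" if "z \<in> W" "v \<notin> E" for z v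
    proof -
      have "v \<notin> s z" using that Wiff by blast
      then show ?thesis by (simp add: s_def)
    qed
    with xy(1,2) have "f x v = f y v" if "v \<notin> E" for v
      using that by metis
    ultimately have "f x = f y" by blast
    then show "x = y" using inj xy by (auto simp: Wiff inj_on_def)
  qed
  moreover have "W \<noteq> {}" using x0 Wiff by auto
  ultimately have "n \<le> m"
    using Euclidean_space_injective_imp_le[OF Wop _ gc] by blast
  then show thesis using that[OF EK] m by simp
qed

text \<open>The open simplex spanned by E, in barycentric coordinates with the last one omitted, is
  an open subset of m-space.\<close>

lemma face_open_embedding:
  assumes K: "fin_simplicial_complex K" and E: "E \<in> K" "card E = Suc m"
  obtains U f where "openin (Euclidean_space m) U" "U \<noteq> {}"
    "continuous_map (subtopology (Euclidean_space m) U) (realization K) f" "inj_on f U"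
proof -
  have finE: "finite E" using E(1) K by (auto simp: fin_simplicial_complex_def)
  obtain b where b: "bij_betw b {..<Suc m} E"
    using ex_bij_betw_nat_finite[OF finE] E(2) by (auto simp: atLeast0LessThan)
  define k where "k = inv_into {..<Suc m} b"
  have kb: "k (b i) = i" if "i < Suc m" for i
    using b that by (simp add: k_def bij_betw_def inv_into_f_f)
  define bary where "bary = (\<lambda>(x::nat \<Rightarrow> real) i. if i < m then x i else 1 - (\<Sum>j<m. x j))"
  define U where "U = {x \<in> topspace (Euclidean_space m). \<forall>i\<in>{..m}. bary x i \<in> {0<..}}"
  define f where "f = (\<lambda>x v. if v \<in> E then bary x (k v) else 0)"
  have cb: "continuous_map (Euclidean_space m) euclideanreal (\<lambda>x. bary x i)" for i
    unfolding bary_def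
    by (cases "i < m")
       (auto intro!: continuous_intros continuous_map_Euclidean_space_coordinate)
  have "U = topspace (Euclidean_space m) \<inter>
      (\<Inter>i\<in>{..m}. {x \<in> topspace (Euclidean_space m). bary x i \<in> {0<..}})"
    by (auto simp: U_def)
  also have "openin (Euclidean_space m) \<dots>"
    by (intro openin_Int openin_topspace openin_INT2 openin_continuous_map_preimage[OF cb]) auto
  finally have Uop: "openin (Euclidean_space m) U" .
  \<comment> \<open>The last barycentric coordinate of this point is 1/2, or 1 if m = 0.\<close>
  have "(\<lambda>i. if i < m then 1 / (2 * real m) else 0) \<in> U"
    by (auto simp: U_def bary_def topspace_Euclidean_space)
  then have Une: "U \<noteq> {}" by blast
  have in_K: "f x \<in> realization_points K" if x: "x \<in> U" for x
  proof -
    have pos: "bary x i > 0" if "i < Suc m" for i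
      using x that by (auto simp: U_def)
    have kE: "k v < Suc m" if "v \<in> E" for v
      using b that by (metis bij_betw_def imageE kb lessThan_iff)
    have supp: "{v. f x v \<noteq> 0} = E"
      using pos kE by (force simp: f_def)
    have "(\<Sum>v\<in>E. f x v) = (\<Sum>i<Suc m. f x (b i))"
      by (rule sum.reindex_bij_betw[OF b, symmetric])
    also have "\<dots> = (\<Sum>i<Suc m. bary x i)"
      using b by (intro sum.cong) (auto simp: f_def kb bij_betw_def)
    also have "\<dots> = 1" by (simp add: bary_def)
    finally show ?thesis
      using supp E(1) pos kE by (auto simp: realization_points_def f_def less_imp_le)
  qed
  have "continuous_map (Euclidean_space m) euclideanreal (\<lambda>x. f x v)" for v
    by (cases "v \<in> E") (simp_all add: f_def cb)
  then have fc: "continuous_map (subtopology (Euclidean_space m) U) (realization K) f"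
    using in_K by (auto simp: continuous_map_into_realization intro: continuous_map_from_subtopology)
  have "inj_on f U"
  proof (rule inj_onI)
    fix x y assume xy: "x \<in> U" "y \<in> U" "f x = f y"
    show "x = y"
    proof
      fix i
      show "x i = y i"
      proof (cases "i < m")
        case True
        then have "b i \<in> E" using b by (auto simp: bij_betw_def)
        then show ?thesis
          using fun_cong[OF xy(3), of "b i"] True by (simp add: f_def kb bary_def)
      next
        case False
        then show ?thesis using xy(1,2) by (auto simp: U_def topspace_Euclidean_space)
      qed
    qed
  qed
  then show thesis using that Uop Une fc by blast
qed

text \<open>Each nonempty face E yields an injective continuous map from an open set of dimension
  |E| - 1 into n-space, so |E| - 1 \<le> n. Conversely the open unit ball embeds in the realization,
  which forces a face with more than n vertices.\<close>

lemma ball_max_card: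
  assumes K: "fin_simplicial_complex K"
    and hom: "realization K homeomorphic_space closed_ball_top n"
  shows "K \<noteq> {}" and "Max (card ` K) = Suc n"
proof -
  from hom obtain \<phi> \<psi> where hm: "homeomorphic_maps (realization K) (closed_ball_top n) \<phi> \<psi>"
    by (auto simp: homeomorphic_space_def)
  then have \<phi>: "continuous_map (realization K) (closed_ball_top n) \<phi>"
    and \<psi>: "continuous_map (closed_ball_top n) (realization K) \<psi>"
    and inj\<phi>: "inj_on \<phi> (realization_points K)"
    and inj\<psi>: "inj_on \<psi> (topspace (closed_ball_top n))"
    by (auto simp: homeomorphic_maps_def intro: inj_on_inverseI)
  have le: "card E \<le> Suc n" if "E \<in> K" for E
  proof (cases "card E")
    case (Suc m)
    obtain U f where U: "openin (Euclidean_space m) U" "U \<noteq> {}"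
      and f: "continuous_map (subtopology (Euclidean_space m) U) (realization K) f" and "inj_on f U"
      using face_open_embedding[OF K \<open>E \<in> K\<close> Suc] by blast
    have "f ` U \<subseteq> realization_points K"
      using continuous_map_image_subset_topspace[OF f] openin_subset[OF U(1)] by (auto simp: Int_absorb1)
    then have "inj_on (\<phi> \<circ> f) U"
      using \<open>inj_on f U\<close> inj\<phi> by (meson comp_inj_on inj_on_subset)
    moreover have "continuous_map (subtopology (Euclidean_space m) U) (Euclidean_space n) (\<phi> \<circ> f)"
      using continuous_map_compose[OF f \<phi>]
      by (auto simp: closed_ball_top_def intro: continuous_map_into_fulltopology)
    ultimately have "m \<le> n"
      using Euclidean_space_injective_imp_le[OF U] by blast
    then show ?thesis using Suc by simp
  qed simp
  \<comment> \<open>Only the open ball will do here: the closed ball is not open in n-space for n >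
    0.\<close>
  define B where "B = {x \<in> topspace (Euclidean_space n). (\<Sum>i<n. (x i)\<^sup>2) \<in> {..<1}}"
  have "openin (Euclidean_space n) B"
    unfolding B_def
    by (rule openin_continuous_map_preimage[where Y = euclideanreal])
       (intro continuous_intros continuous_map_Euclidean_space_coordinate, auto)
  moreover have "(\<lambda>i. 0) \<in> B"
    by (auto simp: B_def topspace_Euclidean_space)
  moreover have "B \<subseteq> topspace (closed_ball_top n)"
    by (auto simp: B_def closed_ball_top_def)
  moreover from this have "subtopology (Euclidean_space n) B = subtopology (closed_ball_top n) B"
    by (auto simp: closed_ball_top_def subtopology_subtopology Int_absorb1)
  ultimately obtain E where E: "E \<in> K" "n < card E"
    using support_face_of_open_embedding[OF K, of n B \<psi>]
      continuous_map_from_subtopology[OF \<psi>, of B] inj_on_subset[OF inj\<psi>, of B]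
    by (metis empty_iff)
  then show "K \<noteq> {}" by blast
  have "finite (card ` K)"
    using K by (simp add: fin_simplicial_complex_def)
  with E le show "Max (card ` K) = Suc n"
    by (intro Max_eqI) (auto simp: image_iff intro!: bexI[of _ E] antisym)
qed

section \<open>Derangement polynomials\<close>

definition xvar :: "int poly" where "xvar = [:0, 1:]"

definition wvar :: "int poly" where "wvar = [:1, -1:]"

lemma wvar_eq: "wvar = 1 - xvar"
  by (simp add: wvar_def xvar_def one_pCons)

lemma wvar_nonzero: "wvar \<noteq> 0"
  by (simp add: wvar_def)

lemma pderiv_xvar: "pderiv xvar = 1"
  by (simp add: xvar_def pderiv_pCons)

lemma pderiv_wvar: "pderiv wvar = - 1"
  by (simp add: wvar_eq pderiv_diff pderiv_xvar)

lemma pderiv_sum: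
  fixes f :: "'b \<Rightarrow> 'a::idom poly"
  shows "pderiv (sum f A) = (\<Sum>x\<in>A. pderiv (f x))"
  using higher_pderiv_sum[of 1 f A] by simp

text \<open>The extra factor p avoids the exponent n - 1 and a separate case n = 0.\<close>

lemma mult_pderiv_power:
  fixes p :: "'a::idom poly"
  shows "p * pderiv (p ^ n) = of_nat n * p ^ n * pderiv p"
  by (induction n) (simp_all add: pderiv_mult algebra_simps)

section \<open>The recurrence for derangement polynomials\<close>

definition derangements :: "nat set \<Rightarrow> (nat \<Rightarrow> nat) set" where
  "derangements S = {\<pi>. \<pi> permutes S \<and> (\<forall>i\<in>S. \<pi> i \<noteq> i)}"

definition exc_set :: "nat set \<Rightarrow> (nat \<Rightarrow> nat) \<Rightarrow> nat set" where
  "exc_set S \<pi> = {i \<in> S. \<pi> i > i}"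

text \<open>General ground sets are used because the recursion passes to \<open>S - {i}\<close>,
  which need not be an initial segment.\<close>

definition derangement_poly_on :: "nat set \<Rightarrow> int poly" where
  "derangement_poly_on S = (\<Sum>\<pi>\<in>derangements S. xvar ^ card (exc_set S \<pi>))"

lemma derangement_poly_eq_on: "derangement_poly n = derangement_poly_on {1..n}"
  by (simp add: derangement_poly_def derangement_poly_on_def derangements_def exc_def exc_set_def
      xvar_def)

lemma finite_exc_set [simp]: "finite S \<Longrightarrow> finite (exc_set S \<pi>)"
  by (simp add: exc_set_def)

text \<open>With t = |T|, inserting i raises the exponent for |S| - t choices of i and keeps it for
  the other t. The derivative absorbs the dependence on t, so the formula can be summed over
  derangements.\<close>

lemma sum_insert_exc:
  assumes "finite S" "T \<subseteq> S"
  shows "(\<Sum>i\<in>S. xvar ^ card (insert i T)) =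
    of_nat (card S) * xvar * xvar ^ card T + xvar * wvar * pderiv (xvar ^ card T)"
proof -
  have fT: "finite T" using assms finite_subset by blast
  have "(\<Sum>i\<in>S. xvar ^ card (insert i T)) =
      (\<Sum>i\<in>S - T. xvar ^ card (insert i T)) + (\<Sum>i\<in>T. xvar ^ card (insert i T))"
    using assms by (subst sum.subset_diff[of T S]) auto
  also have "(\<Sum>i\<in>S - T. xvar ^ card (insert i T)) = (\<Sum>i\<in>S - T. xvar ^ Suc (card T))"
    using fT by (intro sum.cong) auto
  also have "(\<Sum>i\<in>T. xvar ^ card (insert i T)) = (\<Sum>i\<in>T. xvar ^ card T)"
    by (intro sum.cong) (auto simp: insert_absorb)
  finally have *: "(\<Sum>i\<in>S. xvar ^ card (insert i T)) =
      (of_nat (card S) - of_nat (card T)) * xvar ^ Suc (card T) + of_nat (card T) * xvar ^ card T"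
    using assms fT by (simp add: card_Diff_subset card_mono of_nat_diff)
  have "xvar * wvar * pderiv (xvar ^ card T) = wvar * (xvar * pderiv (xvar ^ card T))"
    by (simp only: mult_ac)
  also have "\<dots> = (1 - xvar) * (of_nat (card T) * xvar ^ card T)"
    by (simp add: mult_pderiv_power pderiv_xvar wvar_eq)
  finally have **: "xvar * wvar * pderiv (xvar ^ card T) = (1 - xvar) * (of_nat (card T) * xvar ^ card T)" .
  show ?thesis unfolding * ** by (simp add: algebra_simps)
qed

text \<open>A permutation of \<open>S \<union> {m}\<close> moving \<open>m\<close> arises from a permutation \<open>q\<close> of \<open>S\<close> by inserting \<open>m\<close>
  between \<open>i\<close> and \<open>q i\<close> in a cycle of \<open>q\<close>.\<close>

lemma derangement_insert_iff:
  assumes q: "q permutes S" and m: "m \<notin> S" and i: "i \<in> S"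
  shows "Transposition.transpose m (q i) \<circ> q \<in> derangements (insert m S) \<longleftrightarrow> (\<forall>j\<in>S - {i}. q j \<noteq> j)"
proof -
  have inj: "q j = q k \<longleftrightarrow> j = k" for j k
    using permutes_inj[OF q] by (auto dest: injD)
  have qS: "q j \<in> S" if "j \<in> S" for j
    using permutes_in_image[OF q] that by simp
  have qm: "q m = m" using q m by (simp add: permutes_not_in)
  have "Transposition.transpose m (q i) \<circ> q permutes insert m S"
    using q qS[OF i] by (intro permutes_compose permutes_swap_id) (auto intro: permutes_subset)
  moreover have "(Transposition.transpose m (q i) \<circ> q) m \<noteq> m"
    using qm qS[OF i] m by auto
  moreover have "(Transposition.transpose m (q i) \<circ> q) j = (if j = i then m else q j)" if "j \<in> S" for j
    using qS[OF that] m inj by (auto simp: Transposition.transpose_def)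
  ultimately show ?thesis
    using m i by (auto simp: derangements_def)
qed

text \<open>Since m exceeds all of S, i becomes an excedance by mapping to m, and m is none; all
  other values are unchanged.\<close>

lemma exc_set_insert:
  assumes q: "q permutes S" and m: "\<And>j. j \<in> S \<Longrightarrow> j < m" and i: "i \<in> S"
  shows "exc_set (insert m S) (Transposition.transpose m (q i) \<circ> q) = insert i (exc_set S q)"
proof -
  have mS: "m \<notin> S" using m by blast
  have inj: "q j = q k \<longleftrightarrow> j = k" for j k
    using permutes_inj[OF q] by (auto dest: injD)
  have qS: "q j \<in> S" if "j \<in> S" for j
    using permutes_in_image[OF q] that by simp
  have qm: "q m = m" using q mS by (simp add: permutes_not_in)
  have "(Transposition.transpose m (q i) \<circ> q) j = (if j = i then m else q j)" if "j \<in> S" for j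
    using qS[OF that] mS inj by (auto simp: Transposition.transpose_def)
  moreover have "(Transposition.transpose m (q i) \<circ> q) m < m"
    using qm m qS[OF i] by simp
  ultimately show ?thesis
    using m i by (auto simp: exc_set_def)
qed

text \<open>Deleting m from its cycle in a derangement leaves a derangement of S, or a permutation
  whose only fixed point i formed a 2-cycle with m. The first case gives the first two terms by
  \<open>sum_insert_exc\<close>, the second gives the last sum.\<close>

lemma derangement_poly_on_insert:
  assumes S: "finite S" and m: "\<And>j. j \<in> S \<Longrightarrow> j < m"
  shows "derangement_poly_on (insert m S) =
    of_nat (card S) * xvar * derangement_poly_on S + xvar * wvar * pderiv (derangement_poly_on S)
    + xvar * (\<Sum>i\<in>S. derangement_poly_on (S - {i}))"
proof -
  define P where "P = {q. q permutes S}"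
  have finP: "finite P" using finite_permutations[OF S] by (simp add: P_def)
  have mS: "m \<notin> S" using m by blast
  \<comment> \<open>The weight is extended by 0 so that the sum can run over all permutations, which
    decompose as a transposition after some q.\<close>
  define wt where "wt = (\<lambda>\<pi>. if \<pi> \<in> derangements (insert m S)
      then xvar ^ card (exc_set (insert m S) \<pi>) else 0)"
  have "derangement_poly_on (insert m S) = sum wt {\<pi>. \<pi> permutes insert m S}"
    unfolding derangement_poly_on_def wt_def
    using finite_permutations[of "insert m S"] S
    by (intro sum.mono_neutral_cong_left) (auto simp: derangements_def)
  also have "\<dots> = (\<Sum>b\<in>insert m S. \<Sum>q\<in>P. wt (Transposition.transpose m b \<circ> q))"
    unfolding P_def by (rule sum_over_permutations_insert[OF S mS])
  also have "\<dots> = (\<Sum>b\<in>S. \<Sum>q\<in>P. wt (Transposition.transpose m b \<circ> q))"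
  proof -
    have "wt (Transposition.transpose m m \<circ> q) = 0" if "q \<in> P" for q
      using that mS by (auto simp: wt_def derangements_def P_def permutes_not_in)
    then have "(\<Sum>q\<in>P. wt (Transposition.transpose m m \<circ> q)) = 0" by (intro sum.neutral) blast
    then show ?thesis using S mS by simp
  qed
  also have "\<dots> = (\<Sum>q\<in>P. \<Sum>b\<in>S. wt (Transposition.transpose m b \<circ> q))"
    by (rule sum.swap)
  \<comment> \<open>Writing b as \<open>q i\<close> indexes the terms by the element i that is sent
    to m.\<close>
  also have "\<dots> = (\<Sum>q\<in>P. \<Sum>i\<in>S. wt (Transposition.transpose m (q i) \<circ> q))"
    by (intro sum.cong refl sum.reindex_bij_betw[symmetric]) (auto simp: P_def permutes_imp_bij)
  also have "\<dots> = (\<Sum>q\<in>P. \<Sum>i\<in>S. (if q \<in> derangements S then xvar ^ card (insert i (exc_set S q)) else 0)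
       + (if q \<in> derangements (S - {i}) then xvar * xvar ^ card (exc_set (S - {i}) q) else 0))"
  proof (intro sum.cong refl)
    fix q i assume "q \<in> P" and i: "i \<in> S"
    then have q: "q permutes S" by (simp add: P_def)
    have wt: "wt (Transposition.transpose m (q i) \<circ> q) =
        (if \<forall>j\<in>S - {i}. q j \<noteq> j then xvar ^ card (insert i (exc_set S q)) else 0)"
      using derangement_insert_iff[OF q mS i] exc_set_insert[OF q m i] by (simp add: wt_def)
    have D: "q \<in> derangements S \<longleftrightarrow> (\<forall>j\<in>S - {i}. q j \<noteq> j) \<and> q i \<noteq> i"
      using q i by (auto simp: derangements_def)
    have D': "q \<in> derangements (S - {i}) \<longleftrightarrow> (\<forall>j\<in>S - {i}. q j \<noteq> j) \<and> q i = i"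
    proof -
      have "q permutes (S - {i}) \<longleftrightarrow> q i = i"
        using q by (auto simp: permutes_not_in intro: permutes_superset)
      then show ?thesis by (auto simp: derangements_def)
    qed
    have "card (insert i (exc_set S q)) = Suc (card (exc_set (S - {i}) q))" if "q i = i"
    proof -
      have "exc_set S q = exc_set (S - {i}) q" using that by (auto simp: exc_set_def)
      moreover have "i \<notin> exc_set (S - {i}) q" by (simp add: exc_set_def)
      ultimately show ?thesis using S by simp
    qed
    then show "wt (Transposition.transpose m (q i) \<circ> q) =
        (if q \<in> derangements S then xvar ^ card (insert i (exc_set S q)) else 0)
       + (if q \<in> derangements (S - {i}) then xvar * xvar ^ card (exc_set (S - {i}) q) else 0)"
      unfolding wt D D' by (cases "q i = i") simp_all
  qed
  also have "\<dots> = (\<Sum>q\<in>P. if q \<in> derangements S then (\<Sum>i\<in>S. xvar ^ card (insert i (exc_set S q))) else 0)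
      + (\<Sum>i\<in>S. \<Sum>q\<in>P. if q \<in> derangements (S - {i}) then xvar * xvar ^ card (exc_set (S - {i}) q) else 0)"
    unfolding sum.distrib
    by (intro arg_cong2[where f = "(+)"] sum.swap sum.cong refl) simp
  also have "(\<Sum>q\<in>P. if q \<in> derangements S then (\<Sum>i\<in>S. xvar ^ card (insert i (exc_set S q))) else 0)
      = (\<Sum>q\<in>derangements S. \<Sum>i\<in>S. xvar ^ card (insert i (exc_set S q)))"
    using finP by (intro sum.mono_neutral_cong_right) (auto simp: derangements_def P_def)
  also have "\<dots> = (\<Sum>q\<in>derangements S. of_nat (card S) * xvar * xvar ^ card (exc_set S q)
      + xvar * wvar * pderiv (xvar ^ card (exc_set S q)))"
    using S by (intro sum.cong refl sum_insert_exc) (auto simp: exc_set_def)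
  also have "\<dots> = of_nat (card S) * xvar * derangement_poly_on S + xvar * wvar * pderiv (derangement_poly_on S)"
    unfolding derangement_poly_on_def pderiv_sum sum_distrib_left sum.distrib ..
  also have "(\<Sum>i\<in>S. \<Sum>q\<in>P. if q \<in> derangements (S - {i}) then xvar * xvar ^ card (exc_set (S - {i}) q) else 0)
      = (\<Sum>i\<in>S. xvar * derangement_poly_on (S - {i}))"
    unfolding derangement_poly_on_def sum_distrib_left using finP
    by (intro sum.cong refl sum.mono_neutral_cong_right)
       (auto simp: derangements_def P_def intro: permutes_subset)
  finally show ?thesis by (simp only: sum_distrib_left)
qed

text \<open>Apart from |S|, the recurrence at the maximum involves only polynomials of smaller sets,
  so induction applies. Any bijection of the remaining elements matches the sums, whether or not it
  preserves order.\<close>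

lemma derangement_poly_on_card:
  assumes "finite S" "finite T" "card S = card T"
  shows "derangement_poly_on S = derangement_poly_on T"
  using assms
proof (induction "card S" arbitrary: S T rule: less_induct)
  case less
  show ?case
  proof (cases "S = {}")
    case True
    then show ?thesis using less.prems by simp
  next
    case False
    then have T: "T \<noteq> {}" using less.prems by auto
    have peel: "A = insert (Max A) (A - {Max A})" "\<And>j. j \<in> A - {Max A} \<Longrightarrow> j < Max A"
        "Suc (card (A - {Max A})) = card A" if "finite A" "A \<noteq> {}" for A :: "nat set"
    proof -
      have MA: "Max A \<in> A" using that by (rule Max_in)
      then show "A = insert (Max A) (A - {Max A})" by blast
      show "Suc (card (A - {Max A})) = card A" by (rule card_Suc_Diff1[OF that(1) MA])
      show "j < Max A" if "j \<in> A - {Max A}" for j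
        using that Max_ge[OF \<open>finite A\<close>, of j] by (simp add: order.strict_iff_order)
    qed
    define S' T' where "S' = S - {Max S}" and "T' = T - {Max T}"
    note S' = peel[OF less.prems(1) False, folded S'_def]
      and T' = peel[OF less.prems(2) T, folded T'_def]
    have fin: "finite S'" "finite T'" using less.prems by (simp_all add: S'_def T'_def)
    have c: "card S' = card T'" using S'(3) T'(3) less.prems(3) by simp
    have e: "derangement_poly_on S' = derangement_poly_on T'"
      using less.hyps[of S' T'] S'(3) fin c by simp
    obtain h where h: "bij_betw h S' T'"
      using finite_same_card_bij[OF fin c] by blast
    have "(\<Sum>i\<in>S'. derangement_poly_on (S' - {i})) = (\<Sum>i\<in>S'. derangement_poly_on (T' - {h i}))"
    proof (rule sum.cong[OF refl])
      fix i assume i: "i \<in> S'"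
      then have "h i \<in> T'" using h by (auto simp: bij_betw_def)
      with i c have eq: "card (S' - {i}) = card (T' - {h i})"
        using fin by simp
      have lt: "card (S' - {i}) < card S"
        using S'(3) card_Diff1_le[of S' i] by simp
      show "derangement_poly_on (S' - {i}) = derangement_poly_on (T' - {h i})"
        by (rule less.hyps[OF lt _ _ eq]) (use fin in auto)
    qed
    also have "\<dots> = (\<Sum>i\<in>T'. derangement_poly_on (T' - {i}))"
      by (rule sum.reindex_bij_betw[OF h])
    finally show ?thesis
      using derangement_poly_on_insert[OF fin(1) S'(2)] derangement_poly_on_insert[OF fin(2) T'(2)]
        S'(1) T'(1) c e by metis
  qed
qed

text \<open>For n = 0 the truncated index \<open>n - 1\<close> is harmless, as its coefficient
  vanishes.\<close>

lemma derangement_poly_Suc: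
  "derangement_poly (Suc n) =
    of_nat n * xvar * derangement_poly n + xvar * wvar * pderiv (derangement_poly n)
    + of_nat n * xvar * derangement_poly (n - 1)"
proof -
  have "(\<Sum>i\<in>{1..n}. derangement_poly_on ({1..n} - {i})) = (\<Sum>i\<in>{1..n}. derangement_poly_on {1..n - 1})"
    by (intro sum.cong refl derangement_poly_on_card) auto
  moreover have "{1..Suc n} = insert (Suc n) {1..n}" by auto
  ultimately show ?thesis
    using derangement_poly_on_insert[of "{1..n}" "Suc n"]
    by (simp add: derangement_poly_eq_on algebra_simps)
qed

section \<open>Binomial convolution of derangement polynomials with powers of 1 - x\<close>

definition binom_conv :: "nat \<Rightarrow> int poly" where
  "binom_conv n = (\<Sum>k\<le>n. of_nat (n choose k) * wvar ^ k * derangement_poly (n - k))"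

lemma sum_binomial_Suc:
  fixes c :: "nat \<Rightarrow> 'a::comm_semiring_1"
  shows "(\<Sum>k\<le>Suc n. of_nat (Suc n choose k) * c k) =
    (\<Sum>k\<le>n. of_nat (n choose k) * c (Suc k)) + (\<Sum>k\<le>n. of_nat (n choose k) * c k)"
proof -
  have "(\<Sum>k\<le>Suc n. of_nat (Suc n choose k) * c k) =
      c 0 + (\<Sum>k\<le>n. of_nat (n choose k) * c (Suc k) + of_nat (n choose Suc k) * c (Suc k))"
    by (subst sum.atMost_Suc_shift) (simp add: algebra_simps)
  also have "\<dots> = (\<Sum>k\<le>n. of_nat (n choose k) * c (Suc k)) + (\<Sum>k\<le>Suc n. of_nat (n choose k) * c k)"
    using sum.atMost_Suc_shift[of "\<lambda>k. of_nat (n choose k) * c k" n]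
    by (simp add: sum.distrib algebra_simps del: sum.atMost_Suc)
  finally show ?thesis by (simp add: binomial_eq_0 del: binomial_Suc_Suc)
qed

text \<open>After Pascal's rule, the derangement recurrence is applied to
  \<open>derangement_poly (Suc n - k)\<close>. Differentiating \<open>wvar ^ k\<close> supplies the
  term that turns the factor n - k into n; the last term uses (n - k) (n choose k) = n (n - 1 choose
  k).\<close>

lemma binom_conv_Suc:
  "binom_conv (Suc n) = of_nat n * xvar * binom_conv n + wvar * binom_conv n
    + xvar * wvar * pderiv (binom_conv n) + of_nat n * xvar * binom_conv (n - 1)"
proof -
  let ?d = derangement_poly
  let ?c = "\<lambda>k. of_nat (n choose k) :: int poly"
  have lower: "(\<Sum>k\<le>n. ?c k * (of_nat (n - k) * wvar ^ k * ?d (n - k - 1)))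
      = of_nat n * binom_conv (n - 1)"
  proof (cases n)
    case (Suc n')
    have "of_nat (n choose k) * (of_nat (n - k) :: int poly) = of_nat n * of_nat (n' choose k)" if "k \<le> n'" for k
    proof -
      have "(n choose k) * (n - k) = n * (n' choose k)"
        using binomial_absorb_comp[of n k] Suc by (simp add: mult.commute)
      then show ?thesis by (metis of_nat_mult)
    qed
    then have "(\<Sum>k\<le>n'. ?c k * (of_nat (n - k) * wvar ^ k * ?d (n - k - 1)))
        = (\<Sum>k\<le>n'. of_nat n * (of_nat (n' choose k) * wvar ^ k * ?d (n' - k)))"
      using Suc by (intro sum.cong refl) (simp add: mult.assoc[symmetric])
    then show ?thesis by (simp add: Suc binom_conv_def sum_distrib_left)
  qed simp
  have deriv: "xvar * wvar * pderiv (binom_conv n) =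
      (\<Sum>k\<le>n. ?c k * (xvar * wvar * wvar ^ k * pderiv (?d (n - k)) - xvar * of_nat k * wvar ^ k * ?d (n - k)))"
  proof -
    have "xvar * wvar * pderiv (?c k * wvar ^ k * ?d (n - k)) =
        ?c k * (xvar * wvar * wvar ^ k * pderiv (?d (n - k)) + xvar * (wvar * pderiv (wvar ^ k)) * ?d (n - k))" for k
      by (simp add: pderiv_mult pderiv_of_nat algebra_simps)
    then show ?thesis
      unfolding binom_conv_def pderiv_sum sum_distrib_left mult_pderiv_power pderiv_wvar
      by (intro sum.cong refl) (simp add: algebra_simps)
  qed
  have "binom_conv (Suc n) =
      (\<Sum>k\<le>n. ?c k * (wvar ^ Suc k * ?d (n - k))) + (\<Sum>k\<le>n. ?c k * (wvar ^ k * ?d (Suc n - k)))"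
    using sum_binomial_Suc[of n "\<lambda>k. wvar ^ k * ?d (Suc n - k)"]
    by (simp add: binom_conv_def mult.assoc)
  also have "(\<Sum>k\<le>n. ?c k * (wvar ^ Suc k * ?d (n - k))) = wvar * binom_conv n"
    by (simp add: binom_conv_def sum_distrib_left mult_ac)
  also have "(\<Sum>k\<le>n. ?c k * (wvar ^ k * ?d (Suc n - k))) =
      (\<Sum>k\<le>n. of_nat n * xvar * (?c k * wvar ^ k * ?d (n - k))
        + ?c k * (xvar * wvar * wvar ^ k * pderiv (?d (n - k)) - xvar * of_nat k * wvar ^ k * ?d (n - k))
        + xvar * (?c k * (of_nat (n - k) * wvar ^ k * ?d (n - k - 1))))"
    by (intro sum.cong refl) (simp add: Suc_diff_le derangement_poly_Suc of_nat_diff algebra_simps)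
  also have "\<dots> = of_nat n * xvar * binom_conv n + xvar * wvar * pderiv (binom_conv n)
      + xvar * (of_nat n * binom_conv (n - 1))"
    unfolding sum.distrib deriv lower[symmetric] by (simp only: binom_conv_def sum_distrib_left)
  finally show ?thesis by (simp add: algebra_simps)
qed

text \<open>Both sides satisfy the recurrence of \<open>derangement_poly_Suc\<close>. In terms of the exponential
  generating function, the identity says \<open>D(t) (1 - x exp ((1-x) t)) = (1-x) exp (-x t)\<close>.\<close>

lemma derangement_poly_minus_binom_conv:
  "derangement_poly n - xvar * binom_conv n = wvar * (- xvar) ^ n"
proof (induction n rule: less_induct)
  case (less n)
  let ?Q = "\<lambda>n. derangement_poly n - xvar * binom_conv n"
  show ?case
  proof (cases n)
    case 0
    then show ?thesis by (simp add: binom_conv_def derangement_poly_0 wvar_eq)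
  next
    case (Suc m)
    \<comment> \<open>The extra summand \<open>wvar * binom_conv m\<close> is accounted for by the
      derivative of the factor x in \<open>?Q m\<close>.\<close>
    have rec: "?Q (Suc m) = of_nat m * xvar * ?Q m + xvar * wvar * pderiv (?Q m) + of_nat m * xvar * ?Q (m - 1)"
    proof -
      have "pderiv (?Q m) = pderiv (derangement_poly m) - binom_conv m - xvar * pderiv (binom_conv m)"
        by (simp add: pderiv_diff pderiv_mult pderiv_xvar)
      then show ?thesis
        unfolding derangement_poly_Suc binom_conv_Suc by (simp only: ring_distribs) (simp add: algebra_simps)
    qed
    show ?thesis
    proof (cases m)
      case 0
      then show ?thesis using rec less[of 0] Suc by (simp add: pderiv_wvar algebra_simps)
    next
      case (Suc l)
      have "?Q (Suc m) = of_nat m * xvar * (wvar * (- xvar) ^ m)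
          + xvar * wvar * pderiv (wvar * (- xvar) ^ m) + of_nat m * xvar * (wvar * (- xvar) ^ l)"
        using rec less[of m] less[of l] \<open>n = Suc m\<close> Suc by simp
      also have "pderiv (wvar * (- xvar) ^ m) = - ((- xvar) ^ m) - of_nat m * (wvar * (- xvar) ^ l)"
        by (simp add: Suc pderiv_mult pderiv_power pderiv_minus pderiv_xvar pderiv_wvar of_nat_poly
            algebra_simps del: power_Suc)
      \<comment> \<open>The terms with factor m add up to m x w (-x)^l (-x - w + 1) = 0, where w = 1
        - x and l = m - 1.\<close>
      also have "of_nat m * xvar * (wvar * (- xvar) ^ m)
          + xvar * wvar * (- ((- xvar) ^ m) - of_nat m * (wvar * (- xvar) ^ l)) 
          + of_nat m * xvar * (wvar * (- xvar) ^ l) = wvar * (- xvar) ^ Suc m"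
        unfolding wvar_eq Suc power_Suc by (simp add: algebra_simps)
      finally show ?thesis using \<open>n = Suc m\<close> by simp
    qed
  qed
qed

text \<open>Multiplied by 1 - x, the left side becomes the difference just evaluated; 1 - x then
  cancels. The coefficients are those of \<open>carrier_poly\<close> in h(Delta_F) - h(boundary),
  with k = |F| - |G|.\<close>

lemma derangement_poly_inversion:
  "(\<Sum>k\<le>n. of_nat (n choose k) * (if k = 0 then 1 else - xvar * wvar ^ (k - 1)) * derangement_poly (n - k))
    = (- xvar) ^ n" (is "?L = _")
proof -
  have a: "wvar * (if k = 0 then 1 else - xvar * wvar ^ (k - 1)) = (if k = 0 then 1 else 0) - xvar * wvar ^ k" for k
    by (cases k) (simp_all add: wvar_eq algebra_simps)
  have "wvar * ?L = (\<Sum>k\<le>n. of_nat (n choose k) * (wvar * (if k = 0 then 1 else - xvar * wvar ^ (k - 1))) * derangement_poly (n - k))"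
    by (simp only: sum_distrib_left mult_ac)
  also have "\<dots> = (\<Sum>k\<le>n. (if k = 0 then derangement_poly n else 0)
      - xvar * (of_nat (n choose k) * wvar ^ k * derangement_poly (n - k)))"
    unfolding a by (intro sum.cong refl) (simp add: algebra_simps)
  also have "\<dots> = derangement_poly n - xvar * binom_conv n"
    by (simp add: sum_subtractf binom_conv_def sum_distrib_left)
  finally have "wvar * ?L = wvar * (- xvar) ^ n"
    by (simp only: derangement_poly_minus_binom_conv)
  then show ?thesis using wvar_nonzero by (simp only: mult_cancel_left) simp
qed

section \<open>Counting faces by carrier\<close>

lemma h_poly_eq_sum_faces:
  assumes "finite K" "Max (card ` K) = e"
  shows "h_poly K = (\<Sum>E\<in>K. xvar ^ card E * wvar ^ (e - card E))"
proof -
  have le: "card ` K \<subseteq> {0..e}"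
    using assms by auto
  have "(\<Sum>E\<in>K. xvar ^ card E * wvar ^ (e - card E)) =
      (\<Sum>i\<in>{0..e}. \<Sum>E\<in>{E \<in> K. card E = i}. xvar ^ card E * wvar ^ (e - card E))"
    by (rule sum.group[OF assms(1) _ le, symmetric]) simp
  also have "\<dots> = (\<Sum>i\<in>{0..e}. of_nat (num_faces K i) * xvar ^ i * wvar ^ (e - i))"
    by (intro sum.cong refl) (simp add: num_faces_def mult.assoc)
  finally show ?thesis using assms(2) by (simp add: h_poly_def xvar_def wvar_def)
qed

lemma sum_Pow_card:
  fixes c :: "nat \<Rightarrow> 'a::comm_semiring_1"
  assumes "finite W"
  shows "(\<Sum>H\<in>Pow W. c (card H)) = (\<Sum>k\<le>card W. of_nat (card W choose k) * c k)"
proof -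
  have "(\<Sum>H\<in>Pow W. c (card H)) = (\<Sum>k\<le>card W. \<Sum>H\<in>{H \<in> Pow W. card H = k}. c (card H))"
    using assms by (intro sum.group[symmetric]) (auto intro: card_mono)
  also have "\<dots> = (\<Sum>k\<le>card W. of_nat (card W choose k) * c k)"
    using n_subsets[OF assms] by (intro sum.cong refl) simp
  finally show ?thesis .
qed

text \<open>The sets F between G and V correspond to H = F - G inside V - G, and the summand depends
  on H only through |H|. The values b are signs in one application and derangement polynomials in
  the other.\<close>

lemma sum_Pow_Pow_swap:
  fixes g :: "'v set \<Rightarrow> 'b::comm_semiring_1"
  assumes V: "finite V"
  shows "(\<Sum>F\<in>Pow V. (\<Sum>G\<in>Pow F. g G * a (card F - card G)) * b (card V - card F)) =
    (\<Sum>G\<in>Pow V. g G * (\<Sum>k\<le>card V - card G.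
        of_nat ((card V - card G) choose k) * a k * b (card V - card G - k)))"
proof -
  have "(\<Sum>F\<in>Pow V. (\<Sum>G\<in>Pow F. g G * a (card F - card G)) * b (card V - card F)) =
      (\<Sum>F\<in>Pow V. \<Sum>G | G \<in> Pow V \<and> G \<subseteq> F. g G * (a (card F - card G) * b (card V - card F)))"
    by (intro sum.cong refl) (auto simp: sum_distrib_right mult.assoc intro!: sum.cong)
  also have "\<dots> = (\<Sum>G\<in>Pow V. \<Sum>F | F \<in> Pow V \<and> G \<subseteq> F. g G * (a (card F - card G) * b (card V - card F)))"
    using V by (intro sum.swap_restrict) auto
  also have "\<dots> = (\<Sum>G\<in>Pow V. g G * (\<Sum>k\<le>card V - card G.
        of_nat ((card V - card G) choose k) * a k * b (card V - card G - k)))"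
  proof (intro sum.cong refl)
    fix G assume "G \<in> Pow V"
    then have G: "G \<subseteq> V" "finite G" using V finite_subset by auto
    have cW: "card (V - G) = card V - card G"
      using G by (simp add: card_Diff_subset)
    have "(\<Sum>F | F \<in> Pow V \<and> G \<subseteq> F. g G * (a (card F - card G) * b (card V - card F))) =
        (\<Sum>H\<in>Pow (V - G). g G * (a (card H) * b (card V - card G - card H)))"
    proof (rule sum.reindex_bij_witness[of _ "\<lambda>H. G \<union> H" "\<lambda>F. F - G"])
      fix F assume "F \<in> {F \<in> Pow V. G \<subseteq> F}"
      then have "card (F - G) = card F - card G" "card G \<le> card F"
        using G V by (auto simp: card_Diff_subset intro: card_mono finite_subset)
      then show "g G * (a (card (F - G)) * b (card V - card G - card (F - G))) =
          g G * (a (card F - card G) * b (card V - card F))" by simp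
    qed (use G in auto)
    also have "\<dots> = g G * (\<Sum>k\<le>card V - card G.
        of_nat ((card V - card G) choose k) * a k * b (card V - card G - k))"
      using sum_Pow_card[of "V - G" "\<lambda>k. a k * b (card V - card G - k)"] V cW
      by (simp add: mult.assoc flip: sum_distrib_left)
    finally show "(\<Sum>F | F \<in> Pow V \<and> G \<subseteq> F. g G * (a (card F - card G) * b (card V - card F))) =
      g G * (\<Sum>k\<le>card V - card G. of_nat ((card V - card G) choose k) * a k * b (card V - card G - k))" .
  qed
  finally show ?thesis .
qed

text \<open>This is the contribution to h(Delta_G) of the interior faces of Delta_G.\<close>

definition carrier_poly :: "'a set set \<Rightarrow> ('a set \<Rightarrow> 'v set) \<Rightarrow> 'v set \<Rightarrow> int poly" where
  "carrier_poly \<Delta> \<sigma> G = (\<Sum>E | E \<in> \<Delta> \<and> \<sigma> E = G. xvar ^ card E * wvar ^ (card G - card E))"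

text \<open>The bounds |E| \<le> |G| \<le> e for G = \<sigma>(E) let the exponent e - |E| split
  without truncation. Taking P to be all subsets or all proper subsets of F covers the ball and its
  boundary.\<close>

lemma sum_faces_by_carrier:
  assumes "finite \<Delta>" "finite P"
    and le: "\<And>E. E \<in> \<Delta> \<Longrightarrow> card E \<le> card (\<sigma> E)"
    and e: "\<And>G. G \<in> P \<Longrightarrow> card G \<le> e"
  shows "(\<Sum>E | E \<in> \<Delta> \<and> \<sigma> E \<in> P. xvar ^ card E * wvar ^ (e - card E)) =
    (\<Sum>G\<in>P. carrier_poly \<Delta> \<sigma> G * wvar ^ (e - card G))"
proof -
  let ?K = "{E \<in> \<Delta>. \<sigma> E \<in> P}"
  have "(\<Sum>E\<in>?K. xvar ^ card E * wvar ^ (e - card E)) =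
      (\<Sum>G\<in>P. \<Sum>E\<in>{E \<in> ?K. \<sigma> E = G}. xvar ^ card E * wvar ^ (e - card E))"
    using assms by (intro sum.group[symmetric]) auto
  also have "\<dots> = (\<Sum>G\<in>P. carrier_poly \<Delta> \<sigma> G * wvar ^ (e - card G))"
  proof (intro sum.cong refl)
    fix G assume G: "G \<in> P"
    then have K: "{E \<in> ?K. \<sigma> E = G} = {E. E \<in> \<Delta> \<and> \<sigma> E = G}" by auto
    have "wvar ^ (e - card E) = wvar ^ (card G - card E) * wvar ^ (e - card G)"
      if "E \<in> \<Delta>" "\<sigma> E = G" for E
      using le[OF that(1)] e[OF G] that(2) by (simp flip: power_add)
    then show "(\<Sum>E\<in>{E \<in> ?K. \<sigma> E = G}. xvar ^ card E * wvar ^ (e - card E)) =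
        carrier_poly \<Delta> \<sigma> G * wvar ^ (e - card G)"
      unfolding K carrier_poly_def sum_distrib_right by (intro sum.cong refl) (simp add: mult.assoc)
  qed
  finally show ?thesis by simp
qed

section \<open>The h-polynomials of the balls Delta_F and their boundaries\<close>

context
  fixes V :: "'v set" and \<Delta> :: "'a set set" and \<sigma> :: "'a set \<Rightarrow> 'v set"
  assumes finV: "finite V" and sub: "is_subdivision V \<Delta> \<sigma>"
begin

lemma finite_subdivision: "finite \<Delta>"
  using sub by (simp add: is_subdivision_def fin_simplicial_complex_def)

text \<open>For empty F the complex is \<open>{{}}\<close> by the convention for dimension -1;
  otherwise \<open>ball_max_card\<close> applies.\<close>

lemma
  assumes F: "F \<subseteq> V"
  shows restr_nonempty: "restr \<Delta> \<sigma> F \<noteq> {}"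
    and Max_card_restr: "Max (card ` restr \<Delta> \<sigma> F) = card F"
proof -
  have K: "fin_simplicial_complex (restr \<Delta> \<sigma> F)"
    and ball: "is_ball_of_dim (restr \<Delta> \<sigma> F) (int (card F) - 1)"
    using sub F by (auto simp: is_subdivision_def)
  have "restr \<Delta> \<sigma> F \<noteq> {} \<and> Max (card ` restr \<Delta> \<sigma> F) = card F"
  proof (cases "card F")
    case 0
    then show ?thesis using ball by (simp add: is_ball_of_dim_def)
  next
    case (Suc n)
    then show ?thesis using ball ball_max_card[OF K, of n] by (simp add: is_ball_of_dim_def)
  qed
  then show "restr \<Delta> \<sigma> F \<noteq> {}" "Max (card ` restr \<Delta> \<sigma> F) = card F" by auto
qed

text \<open>E is a face of the ball Delta_G for G = \<sigma>(E), whose faces have at most |G|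
  vertices.\<close>

lemma card_face_le_carrier:
  assumes "E \<in> \<Delta>"
  shows "card E \<le> card (\<sigma> E)"
proof -
  have "\<sigma> E \<subseteq> V" using sub assms by (auto simp: is_subdivision_def)
  moreover have "E \<in> restr \<Delta> \<sigma> (\<sigma> E)" using assms by (simp add: restr_def)
  moreover have "finite (restr \<Delta> \<sigma> (\<sigma> E))" using finite_subdivision by (simp add: restr_def)
  ultimately show ?thesis using Max_card_restr by (metis Max_ge finite_imageI imageI)
qed

lemma restr_boundary_eq: "restr_boundary \<Delta> \<sigma> F = {E \<in> \<Delta>. \<sigma> E \<in> Pow F - {F}}"
  by (auto simp: restr_boundary_def restr_def)

text \<open>The ball over F minus a vertex already has a face with |F| - 1 vertices; a larger one is
  excluded because its carrier is a proper subset of F.\<close>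

lemma Max_card_restr_boundary:
  assumes F: "F \<subseteq> V" "F \<noteq> {}"
  shows "Max (card ` restr_boundary \<Delta> \<sigma> F) = card F - 1"
proof -
  have finF: "finite F" using F finV finite_subset by blast
  obtain v where v: "v \<in> F" using F by blast
  let ?G = "F - {v}"
  have "?G \<subseteq> V" using F by blast
  have "Max (card ` restr \<Delta> \<sigma> ?G) \<in> card ` restr \<Delta> \<sigma> ?G"
    using restr_nonempty[OF \<open>?G \<subseteq> V\<close>] finite_subdivision by (intro Max_in) (auto simp: restr_def)
  then obtain E where "E \<in> restr \<Delta> \<sigma> ?G" "card E = card F - 1"
    using Max_card_restr[OF \<open>?G \<subseteq> V\<close>] v finF by auto
  moreover from this have "E \<in> restr_boundary \<Delta> \<sigma> F"
    using v by (auto simp: restr_boundary_eq restr_def)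
  moreover have "card E \<le> card F - 1" if "E \<in> restr_boundary \<Delta> \<sigma> F" for E
  proof -
    from that have "E \<in> \<Delta>" "\<sigma> E \<subset> F" by (auto simp: restr_boundary_eq)
    then show ?thesis
      using card_face_le_carrier[of E] psubset_card_mono[OF finF, of "\<sigma> E"] by simp
  qed
  ultimately show ?thesis
    using finite_subdivision by (intro Max_eqI) (auto simp: restr_boundary_eq image_iff intro: sym)
qed

lemma h_poly_restr:
  assumes F: "F \<subseteq> V"
  shows "h_poly (restr \<Delta> \<sigma> F) = (\<Sum>G\<in>Pow F. carrier_poly \<Delta> \<sigma> G * wvar ^ (card F - card G))"
proof -
  have finF: "finite F" using F finV finite_subset by blast
  have "h_poly (restr \<Delta> \<sigma> F) = (\<Sum>E\<in>restr \<Delta> \<sigma> F. xvar ^ card E * wvar ^ (card F - card E))"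
    using Max_card_restr[OF F] finite_subdivision by (intro h_poly_eq_sum_faces) (auto simp: restr_def)
  also have "\<dots> = (\<Sum>E | E \<in> \<Delta> \<and> \<sigma> E \<in> Pow F. xvar ^ card E * wvar ^ (card F - card E))"
    by (simp add: restr_def)
  also have "\<dots> = (\<Sum>G\<in>Pow F. carrier_poly \<Delta> \<sigma> G * wvar ^ (card F - card G))"
    using finite_subdivision finF card_face_le_carrier
    by (intro sum_faces_by_carrier) (auto intro: card_mono)
  finally show ?thesis .
qed

lemma h_poly_restr_boundary:
  assumes F: "F \<subseteq> V" "F \<noteq> {}"
  shows "h_poly (restr_boundary \<Delta> \<sigma> F) =
    (\<Sum>G\<in>Pow F - {F}. carrier_poly \<Delta> \<sigma> G * wvar ^ (card F - 1 - card G))"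
proof -
  have finF: "finite F" using F finV finite_subset by blast
  have le: "card G \<le> card F - 1" if "G \<in> Pow F - {F}" for G
  proof -
    have "G \<subset> F" using that by blast
    then show ?thesis using psubset_card_mono[OF finF, of G] by simp
  qed
  have "h_poly (restr_boundary \<Delta> \<sigma> F) =
      (\<Sum>E\<in>restr_boundary \<Delta> \<sigma> F. xvar ^ card E * wvar ^ (card F - 1 - card E))"
    using Max_card_restr_boundary[OF F] finite_subdivision
    by (intro h_poly_eq_sum_faces) (auto simp: restr_boundary_eq)
  also have "\<dots> = (\<Sum>G\<in>Pow F - {F}. carrier_poly \<Delta> \<sigma> G * wvar ^ (card F - 1 - card G))"
    unfolding restr_boundary_eq
    by (rule sum_faces_by_carrier) (use finite_subdivision finF card_face_le_carrier le in auto)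
  finally show ?thesis .
qed

text \<open>The carrier F occurs only in the ball. For proper G and k = |F| - |G|, the coefficient
  is w^k - w^(k-1) = -x w^(k-1) with w = 1 - x. For empty F the boundary is void and contributes
  0.\<close>

lemma h_poly_restr_minus_boundary:
  assumes F: "F \<subseteq> V"
  shows "h_poly (restr \<Delta> \<sigma> F) - h_poly (restr_boundary \<Delta> \<sigma> F) =
    (\<Sum>G\<in>Pow F. carrier_poly \<Delta> \<sigma> G *
      (if card F - card G = 0 then 1 else - xvar * wvar ^ (card F - card G - 1)))"
proof (cases "F = {}")
  case True
  then show ?thesis using h_poly_restr[OF F] by (simp add: restr_boundary_empty h_poly_void)
next
  case False
  have finF: "finite F" using F finV finite_subset by blast
  let ?g = "carrier_poly \<Delta> \<sigma>"
  let ?a = "\<lambda>k. if k = 0 then 1 else - xvar * wvar ^ (k - 1)"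
  have "h_poly (restr \<Delta> \<sigma> F) - h_poly (restr_boundary \<Delta> \<sigma> F) =
      ?g F + (\<Sum>G\<in>Pow F - {F}. ?g G * wvar ^ (card F - card G) - ?g G * wvar ^ (card F - 1 - card G))"
    unfolding h_poly_restr[OF F] h_poly_restr_boundary[OF F False] sum_subtractf
    using finF by (subst sum.remove[of _ F]) auto
  also have "\<dots> = ?g F + (\<Sum>G\<in>Pow F - {F}. ?g G * ?a (card F - card G))"
  proof (intro arg_cong2[where f = "(+)"] refl sum.cong)
    fix G assume "G \<in> Pow F - {F}"
    then have "card G < card F" using psubset_card_mono[OF finF, of G] by blast
    then obtain k where "card F - card G = Suc k" "card F - 1 - card G = k"
      by (metis Suc_diff_Suc diff_Suc_1 diff_commute)
    then show "?g G * wvar ^ (card F - card G) - ?g G * wvar ^ (card F - 1 - card G) = ?g G * ?a (card F - card G)"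
      by (simp add: wvar_eq algebra_simps)
  qed
  also have "\<dots> = (\<Sum>G\<in>Pow F. ?g G * ?a (card F - card G))"
    using finF by (subst (2) sum.remove[of _ F]) auto
  finally show ?thesis .
qed

end

theorem theorem4p4:
  fixes V :: "'v set" and \<Delta> :: "'a set set" and \<sigma> :: "'a set \<Rightarrow> 'v set"
  assumes "finite V" and "V \<noteq> {}"
    and "is_subdivision V \<Delta> \<sigma>"
  shows "local_h_poly V \<Delta> \<sigma> =
    (\<Sum>F\<in>Pow V. (h_poly (restr \<Delta> \<sigma> F) - h_poly (restr_boundary \<Delta> \<sigma> F))
                  * derangement_poly (card (V - F)))"
proof -
  let ?g = "carrier_poly \<Delta> \<sigma>"
  let ?a = "\<lambda>k. if k = 0 then 1 else - xvar * wvar ^ (k - 1)"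
  have "local_h_poly V \<Delta> \<sigma> =
      (\<Sum>F\<in>Pow V. (\<Sum>G\<in>Pow F. ?g G * wvar ^ (card F - card G)) * (- 1) ^ (card V - card F))"
    unfolding local_h_poly_def
    by (intro sum.cong refl) (simp add: h_poly_restr[OF assms(1,3)] mult.commute)
  also have "\<dots> = (\<Sum>G\<in>Pow V. ?g G * (\<Sum>k\<le>card V - card G.
      of_nat ((card V - card G) choose k) * wvar ^ k * (- 1) ^ (card V - card G - k)))"
    by (rule sum_Pow_Pow_swap[OF assms(1)])
  \<comment> \<open>The inner sum is the binomial expansion of ((1 - x) - 1)^n with n = |V| -
    |G|.\<close>
  also have "\<dots> = (\<Sum>G\<in>Pow V. ?g G * (- xvar) ^ (card V - card G))"
  proof -
    have "wvar + - 1 = - xvar" by (simp add: wvar_eq)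
    then show ?thesis by (simp only: binomial_ring[symmetric])
  qed
  also have "\<dots> = (\<Sum>G\<in>Pow V. ?g G * (\<Sum>k\<le>card V - card G.
      of_nat ((card V - card G) choose k) * ?a k * derangement_poly (card V - card G - k)))"
    by (simp only: derangement_poly_inversion)
  \<comment> \<open>The interchange is now run backwards, to collect the terms by F again.\<close>
  also have "\<dots> = (\<Sum>F\<in>Pow V. (\<Sum>G\<in>Pow F. ?g G * ?a (card F - card G)) * derangement_poly (card V - card F))"
    by (rule sum_Pow_Pow_swap[OF assms(1), symmetric])
  also have "\<dots> = (\<Sum>F\<in>Pow V. (h_poly (restr \<Delta> \<sigma> F) - h_poly (restr_boundary \<Delta> \<sigma> F))
      * derangement_poly (card (V - F)))"
    using assms(1)
    by (intro sum.cong refl)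
       (auto simp: h_poly_restr_minus_boundary[OF assms(1,3)] card_Diff_subset finite_subset)
  finally show ?thesis .
qed

end
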